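(* Let $P_{PTC}(a,b,c)$, $a,b,c\in\{0,1\}$, be the distribution arising from the Parity Token Counting strategy $(p_\alpha,p_\beta,p_\gamma)$ on the triangle network, where each source distributes its only token to the connected parties with probabilities $p_i$ and $1-p_i$, and the parties output the parity of the number of received tokens. For any other strategy $\big(\mu(\alpha),\eta(\beta),\nu(\gamma),a(\beta,\gamma),b(\gamma,\alpha),c(\alpha,\beta)\big)$ that achieves the distribution $P_{PTC}(a,b,c)$, there exist functions $T_\alpha^b,T_\alpha^c:\mathcal S_\alpha\to\{0,1\}$, $T_\beta^c,T_\beta^a:\mathcal S_\beta\to\{0,1\}$, $T_\gamma^a,T_\gamma^b:\mathcal S_\gamma\to\{0,1\}$ (where $\mathcal S_\alpha,\mathcal S_\beta,\mathcal S_\gamma$ are the sets of all possible values of the local variables $\alpha,\beta,\gamma$ produced by the respective sources) such that (i) $T_\alpha^b(\alpha)+T_\alpha^c(\alpha)=T_\beta^c(\beta)+T_\beta^a(\beta)=T_\gamma^a(\gamma)+T_\gamma^b(\gamma)=1$; (ii) $a(\beta,\gamma)=T_\beta^a(\beta)\oplus T_\gamma^a(\gamma)$, $\; b(\gamma,\alpha)=T_\gamma^b(\gamma)\oplus T_\alpha^b(\alpha)$, $\; c(\alpha,\beta)=T_\alpha^c(\alpha)\oplus T_\beta^c(\beta)$. In addition, if the distribution is such that $P(a=1),P(b=1),P(c=1)\neq\frac12$, the functions can be chosen to fulfill (iii) $\left(\mathbb E[T_\alpha^b],\mathbb E[T_\beta^c],\mathbb E[T_\gamma^a]\right)=(p_\alpha,p_\beta,p_\gamma)$,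 where $\mathbb E[T_\alpha^b]=\int T_\alpha^b(\alpha)\,d\mu(\alpha)$, and analogously $\mathbb E[T_\beta^c]=\int T_\beta^c(\beta)\,d\eta(\beta)$, $\mathbb E[T_\gamma^a]=\int T_\gamma^a(\gamma)\,d\nu(\gamma)$.
   Context: Throughout, $\oplus$ denotes addition modulo 2. Triangle network: three parties $A,B,C$ (outputs $a,b,c$) and three independent sources: the source $\alpha$ connects $B$ and $C$, the source $\beta$ connects $C$ and $A$, the source $\gamma$ connects $A$ and $B$. A (triangle-local) strategy consists of three probability distributions $\mu(\alpha),\eta(\beta),\nu(\gamma)$ of independent local variables and three deterministic response functions $a(\beta,\gamma)$, $b(\gamma,\alpha)$, $c(\alpha,\beta)$ (here with values in $\{0,1\}$). It achieves the distribution $P(a,b,c)$ if $P$ is the joint law of $(a(\beta,\gamma),b(\gamma,\alpha),c(\alpha,\beta))$ when $\alpha,\beta,\gamma$ are sampled independently from $\mu,\eta,\nu$. Parity Token Counting (PTC) strategy $(p_\alpha,p_\beta,p_\gamma)\in[0,1]^3$: each source has one token that it sends to exactly one of the two parties it connects. Independently, $(\alpha_B,\alpha_C)=(1,0)$ with probability $p_\alpha$ and $(0,1)$ with probability $1-p_\alpha$; $(\beta_C,\beta_A)=(1,0)$ with probability $p_\beta$ and $(0,1)$ with probability $1-p_\beta$; $(\gamma_A,\gamma_B)=(1,0)$ with probability $p_\gamma$ and $(0,1)$ with probability $1-p_\gamma$. Each party outputs the parity of the number of tokens it receives: $a=\beta_A\oplus\gamma_A$, $b=\gamma_B\oplus\alpha_B$,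 $c=\alpha_C\oplus\beta_C$.
   Formalization: The identities (ii) are proved almost everywhere for the product laws of the sources; for all values they can fail for atomless sources (flip a on a null diagonal). For discrete sources they hold at all values of positive probability. *)

theory Defs
  imports "HOL-Probability.Probability"
begin

definition parity_add :: "nat \<Rightarrow> nat \<Rightarrow> nat" (infixl "\<oplus>" 65)
  where "m \<oplus> n = (m + n) mod 2"

text \<open>
  The sources \<alpha>, \<beta>, \<gamma> have laws \<mu>, \<eta>, \<nu> on arbitrary probability spaces, whose underlying
  sets are the sets of possible values of the local variables. Measurability into
  \<open>count_space {0, 1}\<close> also says that the responses take values in \<open>{0, 1}\<close> on these spaces.
\<close>

locale triangle_strategy =
  alpha: prob_space \<mu> + beta: prob_space \<eta> + gamma: prob_space \<nu>
  for \<mu> :: "'s measure" and \<eta> :: "'t measure" and \<nu> :: "'u measure" +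
  fixes a :: "'t \<times> 'u \<Rightarrow> nat" and b :: "'u \<times> 's \<Rightarrow> nat" and c :: "'s \<times> 't \<Rightarrow> nat"
  assumes measurable_a: "a \<in> \<eta> \<Otimes>\<^sub>M \<nu> \<rightarrow>\<^sub>M count_space {0, 1}"
    and measurable_b: "b \<in> \<nu> \<Otimes>\<^sub>M \<mu> \<rightarrow>\<^sub>M count_space {0, 1}"
    and measurable_c: "c \<in> \<mu> \<Otimes>\<^sub>M \<eta> \<rightarrow>\<^sub>M count_space {0, 1}"

definition outcome_law ::
  "'s measure \<Rightarrow> 't measure \<Rightarrow> 'u measure \<Rightarrow>
   ('t \<times> 'u \<Rightarrow> nat) \<Rightarrow> ('u \<times> 's \<Rightarrow> nat) \<Rightarrow> ('s \<times> 't \<Rightarrow> nat) \<Rightarrow> (nat \<times> nat \<times> nat) measure"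
  where "outcome_law \<mu> \<eta> \<nu> a b c =
    distr (\<mu> \<Otimes>\<^sub>M \<eta> \<Otimes>\<^sub>M \<nu>) (count_space UNIV) (\<lambda>(\<alpha>, \<beta>, \<gamma>). (a (\<beta>, \<gamma>), b (\<gamma>, \<alpha>), c (\<alpha>, \<beta>)))"

text \<open>Numbers of tokens sent to the two parties connected to a source.\<close>

definition token_pmf :: "real \<Rightarrow> (nat \<times> nat) pmf"
  where "token_pmf p = map_pmf (\<lambda>first. if first then (1, 0) else (0, 1)) (bernoulli_pmf p)"

definition ptc_pmf :: "real \<Rightarrow> real \<Rightarrow> real \<Rightarrow> (nat \<times> nat \<times> nat) pmf"
  where "ptc_pmf p\<alpha> p\<beta> p\<gamma> =
    do {
      (\<alpha>B, \<alpha>C) \<leftarrow> token_pmf p\<alpha>;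
      (\<beta>C, \<beta>A) \<leftarrow> token_pmf p\<beta>;
      (\<gamma>A, \<gamma>B) \<leftarrow> token_pmf p\<gamma>;
      return_pmf (\<beta>A \<oplus> \<gamma>A, \<gamma>B \<oplus> \<alpha>B, \<alpha>C \<oplus> \<beta>C)
    }"

text \<open>
  The achieved distribution determines the responses only up to null sets of the product measures
  (for atomless sources, changing \<open>a\<close> on a diagonal changes no probability), so identities between
  responses are to be read almost everywhere. At pairs of values that each have positive
  probability, in particular at all possible values of discrete sources, an almost everywhere
  identity holds pointwise:
\<close>

lemma AE_atom:
  assumes "AE z in K. Q z" "{z} \<in> sets K" "emeasure K {z} \<noteq> 0"
  shows "Q z"
proof (rule ccontr)
  assume "\<not> Q z"
  obtain Z where Z: "{z \<in> space K. \<not> Q z} \<subseteq> Z" "emeasure K Z = 0" "Z \<in> sets K"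
    using assms(1) by (rule AE_E)
  moreover have "z \<in> space K" using sets.sets_into_space[OF assms(2)] by auto
  ultimately have "emeasure K {z} \<le> emeasure K Z"
    using \<open>\<not> Q z\<close> by (intro emeasure_mono) auto
  with assms(3) Z(2) show False by simp
qed

lemma AE_pair_measure_atoms:
  assumes "prob_space M" "prob_space N"
    and ae: "AE (x, y) in M \<Otimes>\<^sub>M N. P x y"
    and "{x} \<in> sets M" "emeasure M {x} \<noteq> 0" "{y} \<in> sets N" "emeasure N {y} \<noteq> 0"
  shows "P x y"
proof -
  interpret M: prob_space M by fact
  interpret N: prob_space N by fact
  interpret pair_sigma_finite M N ..
  have "AE x in M. AE y in N. P x y" using AE_pair[OF ae] by simp
  from AE_atom[OF this assms(4,5)] have "AE y in N. P x y" .
  from AE_atom[OF this assms(6,7)] show ?thesis .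
qed

end

theory Submission imports Defs begin

text \<open>
  The three tokens make \<open>a + b + c\<close> odd with probability one, which is a pointwise relation between
  the responses, almost everywhere. Freezing \<open>\<alpha>\<close> at a generic value writes \<open>a(\<beta>, \<gamma>)\<close> as a
  function of \<open>\<beta>\<close> plus a function of \<open>\<gamma>\<close>, modulo 2; freezing \<open>\<beta>\<close> then does the same for
  \<open>b(\<gamma>, \<alpha>)\<close>, and the parity relation gives \<open>c\<close>. This yields the token functions.

  For the means, let \<open>X, Y, Z\<close> be the biases \<open>1 - 2 E[T]\<close> of the three token functions. The
  marginal laws of \<open>a\<close>, \<open>b\<close> and \<open>c\<close> fix the products \<open>YZ\<close>, \<open>ZX\<close> and \<open>XY\<close>. If no marginal is
  uniform, these products are nonzero and determine \<open>(X, Y, Z)\<close> up to a global sign, and the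
  sign is corrected by exchanging the two recipients of every token.
\<close>

section \<open>Measurable functions with values 0 and 1\<close>

lemma measurable_bitD: "f \<in> M \<rightarrow>\<^sub>M count_space {0, 1::nat} \<Longrightarrow> x \<in> space M \<Longrightarrow> f x = 0 \<or> f x = 1"
  by (drule measurable_space) auto

lemma measurable_flip:
  assumes "f \<in> M \<rightarrow>\<^sub>M count_space {0, 1::nat}"
  shows "(\<lambda>x. 1 - f x) \<in> M \<rightarrow>\<^sub>M count_space {0, 1}"
  by (rule measurable_compose[OF assms]) auto

lemma measurable_parity_add:
  assumes f: "f \<in> M \<rightarrow>\<^sub>M count_space {0, 1::nat}" and g: "g \<in> M \<rightarrow>\<^sub>M count_space {0, 1::nat}"
  shows "(\<lambda>x. f x \<oplus> g x) \<in> M \<rightarrow>\<^sub>M count_space {0, 1}"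
proof (rule measurable_compose_countable'[where f="\<lambda>i x. i \<oplus> g x" and g=f, OF _ f])
  show "(\<lambda>x. i \<oplus> g x) \<in> M \<rightarrow>\<^sub>M count_space {0, 1}" for i
    by (rule measurable_compose[OF g]) (auto simp: parity_add_def)
qed simp

section \<open>Recovering three biases from their pairwise products\<close>

text \<open>With \<open>y = 1 - 2 * q\<close> and \<open>z = 1 - 2 * r\<close>, the expression
  \<open>(1 - q) * (1 - r) + q * r\<close> is \<open>(1 + y * z) / 2\<close>. The hypotheses thus
  equate pairwise products of biases and say that none of them vanishes.\<close>

lemma sign_ambiguity:
  fixes p q r p' q' r' :: real
  assumes "(1 - q') * (1 - r') + q' * r' = (1 - q) * (1 - r) + q * r"
    and "(1 - r') * (1 - p') + r' * p' = (1 - r) * (1 - p) + r * p"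
    and "(1 - p') * (1 - q') + p' * q' = (1 - p) * (1 - q) + p * q"
    and "(1 - q) * (1 - r) + q * r \<noteq> 1 / 2"
    and "(1 - r) * (1 - p) + r * p \<noteq> 1 / 2"
    and "(1 - p) * (1 - q) + p * q \<noteq> 1 / 2"
  shows "p' = p \<and> q' = q \<and> r' = r \<or> 1 - p' = p \<and> 1 - q' = q \<and> 1 - r' = r"
proof -
  define x y z x' y' z' where d: "x = 1 - 2 * p" "y = 1 - 2 * q" "z = 1 - 2 * r"
    "x' = 1 - 2 * p'" "y' = 1 - 2 * q'" "z' = 1 - 2 * r'"
  have e: "y' * z' = y * z" "z' * x' = z * x" "x' * y' = x * y"
    using assms(1-3) unfolding d by (simp_all add: algebra_simps)
  have n: "y * z \<noteq> 0" "z * x \<noteq> 0" "x * y \<noteq> 0"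
    using assms(4-6) unfolding d by (auto simp: algebra_simps)
  \<comment> \<open>The left side is the product of \<open>x' * y'\<close> and
    \<open>z' * x'\<close>, the two known products that contain \<open>x'\<close>. Cancelling the
    third one leaves \<open>x'\<close> known up to sign.\<close>
  have "x'^2 * (y' * z') = x^2 * (y * z)"
    using e by (metis (no_types, lifting) mult.assoc mult.commute power2_eq_square)
  then have "x'^2 = x^2" using e(1) n(1) by simp
  then consider "x' = x" | "x' = - x" by (auto simp: power2_eq_iff)
  \<comment> \<open>Since \<open>x\<close> is nonzero, its sign passes to \<open>y'\<close> and
    \<open>z'\<close> through \<open>x' * y' = x * y\<close> and
    \<open>z' * x' = z * x\<close>.\<close>
  then have "x' = x \<and> y' = y \<and> z' = z \<or> x' = - x \<and> y' = - y \<and> z' = - z"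
    using e n by cases (auto, (metis mult_minus_left mult_minus_right mult_left_cancel mult.commute)+)
  then show ?thesis unfolding d by auto
qed

section \<open>Means of bits and of their parities\<close>

lemma integral_flip:
  assumes "prob_space M" and f: "f \<in> M \<rightarrow>\<^sub>M count_space {0, 1::nat}"
  shows "(\<integral>x. real (1 - f x) \<partial>M) = 1 - (\<integral>x. f x \<partial>M)"
proof -
  interpret prob_space M by fact
  have "(\<lambda>x. real (f x)) \<in> borel_measurable M" by (rule measurable_compose[OF f]) simp
  then have "integrable M (\<lambda>x. real (f x))"
    by (rule integrable_const_bound[rotated, where B=1]) (auto intro!: AE_I2 dest: measurable_bitD[OF f])
  then have "(\<integral>x. 1 - real (f x) \<partial>M) = 1 - (\<integral>x. f x \<partial>M)" by (simp add: prob_space)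
  \<comment> \<open>The subtraction inside \<open>real\<close> is truncated; it agrees with the real
    one because \<open>f\<close> is at most 1 on the space.\<close>
  moreover have "(\<integral>x. real (1 - f x) \<partial>M) = (\<integral>x. 1 - real (f x) \<partial>M)"
    by (rule Bochner_Integration.integral_cong) (auto dest: measurable_bitD[OF f])
  ultimately show ?thesis by simp
qed

text \<open>Parity one means that exactly one of the two bits is set, which is a disjoint union of
  two rectangles, and the product measure factorises on each. Agreement of \<open>h\<close> with the
  parity is assumed only almost everywhere, since no more is known of the responses.\<close>

lemma prob_parity:
  assumes "prob_space M" "prob_space N"
    and f: "f \<in> M \<rightarrow>\<^sub>M count_space {0, 1::nat}" and g: "g \<in> N \<rightarrow>\<^sub>M count_space {0, 1::nat}"
    and h: "h \<in> M \<Otimes>\<^sub>M N \<rightarrow>\<^sub>M count_space {0, 1::nat}"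
    and ae: "AE (x, y) in M \<Otimes>\<^sub>M N. h (x, y) = f x \<oplus> g y"
  shows "measure (M \<Otimes>\<^sub>M N) {z \<in> space (M \<Otimes>\<^sub>M N). h z = 1}
    = (\<integral>x. f x \<partial>M) * (1 - (\<integral>y. g y \<partial>N)) + (1 - (\<integral>x. f x \<partial>M)) * (\<integral>y. g y \<partial>N)"
proof -
  interpret M: prob_space M by fact
  interpret N: prob_space N by fact
  interpret MN: pair_prob_space M N ..
  define F where "F i = f -` {i} \<inter> space M" for i
  define G where "G i = g -` {i} \<inter> space N" for i
  have F: "F i \<in> sets M" if "i = 0 \<or> i = 1" for i
    unfolding F_def using that by (intro measurable_sets[OF f]) auto
  have G: "G i \<in> sets N" if "i = 0 \<or> i = 1" for i
    unfolding G_def using that by (intro measurable_sets[OF g]) auto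
  have "(\<integral>x. f x \<partial>M) = (\<integral>x. indicator (F 1) x \<partial>M)"
    by (intro Bochner_Integration.integral_cong) (auto simp: F_def indicator_def dest!: measurable_bitD[OF f])
  then have Ef: "(\<integral>x. f x \<partial>M) = measure M (F 1)" using F[of 1] by simp
  have "(\<integral>x. g x \<partial>N) = (\<integral>x. indicator (G 1) x \<partial>N)"
    by (intro Bochner_Integration.integral_cong) (auto simp: G_def indicator_def dest!: measurable_bitD[OF g])
  then have Eg: "(\<integral>x. g x \<partial>N) = measure N (G 1)" using G[of 1] by simp
  have "F 0 = space M - F 1" "G 0 = space N - G 1"
    by (auto simp: F_def G_def dest: measurable_bitD[OF f] measurable_bitD[OF g])
  then have 0: "measure M (F 0) = 1 - measure M (F 1)" "measure N (G 0) = 1 - measure N (G 1)"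
    using M.prob_compl[of "F 1"] N.prob_compl[of "G 1"] F[of 1] G[of 1] by auto
  have "measure (M \<Otimes>\<^sub>M N) {z \<in> space (M \<Otimes>\<^sub>M N). h z = 1} = measure (M \<Otimes>\<^sub>M N) (F 1 \<times> G 0 \<union> F 0 \<times> G 1)"
  proof (rule MN.P.finite_measure_eq_AE)
    show "AE z in M \<Otimes>\<^sub>M N. (z \<in> {z \<in> space (M \<Otimes>\<^sub>M N). h z = 1}) = (z \<in> F 1 \<times> G 0 \<union> F 0 \<times> G 1)"
      using ae AE_space
    proof eventually_elim
      case (elim z)
      then obtain x y where "z = (x, y)" "x \<in> space M" "y \<in> space N" by (auto simp: space_pair_measure)
      with elim measurable_bitD[OF f, of x] measurable_bitD[OF g, of y] show ?case
        by (auto simp: F_def G_def parity_add_def space_pair_measure)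
    qed
    have "h -` {1} \<inter> space (M \<Otimes>\<^sub>M N) \<in> sets (M \<Otimes>\<^sub>M N)"
      by (intro measurable_sets[OF h]) auto
    then show "{z \<in> space (M \<Otimes>\<^sub>M N). h z = 1} \<in> sets (M \<Otimes>\<^sub>M N)"
      by (simp add: vimage_def Int_def conj_commute)
  qed (use F G in auto)
  also have "\<dots> = measure (M \<Otimes>\<^sub>M N) (F 1 \<times> G 0) + measure (M \<Otimes>\<^sub>M N) (F 0 \<times> G 1)"
    using F G by (intro MN.P.finite_measure_Union) (auto simp: F_def)
  also have "\<dots> = measure M (F 1) * measure N (G 0) + measure M (F 0) * measure N (G 1)"
    using F G by (simp add: measure_def N.emeasure_pair_measure_Times enn2real_mult)
  finally show ?thesis using 0 Ef Eg by simp
qed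

section \<open>The parity token counting distribution\<close>

text \<open>The probabilities \<open>p\<alpha>\<close>, \<open>p\<beta>\<close>,
  \<open>p\<gamma>\<close> all refer to the same sense of rotation around the triangle. A party
  receives exactly one token iff the tokens of its two sources move in the same sense, hence the
  products of like factors.\<close>

lemma ptc_marginals:
  assumes "p\<alpha> \<in> {0..1}" "p\<beta> \<in> {0..1}" "p\<gamma> \<in> {0..1}"
  shows "measure_pmf.prob (ptc_pmf p\<alpha> p\<beta> p\<gamma>) {(x, y, z). x = 1} = (1 - p\<beta>) * (1 - p\<gamma>) + p\<beta> * p\<gamma>"
    and "measure_pmf.prob (ptc_pmf p\<alpha> p\<beta> p\<gamma>) {(x, y, z). y = 1} = (1 - p\<gamma>) * (1 - p\<alpha>) + p\<gamma> * p\<alpha>"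
    and "measure_pmf.prob (ptc_pmf p\<alpha> p\<beta> p\<gamma>) {(x, y, z). z = 1} = (1 - p\<alpha>) * (1 - p\<beta>) + p\<alpha> * p\<beta>"
proof -
  \<comment> \<open>Total probability, together with the two-point mean in \<open>token\<close>,
    expands the nested binds into a polynomial in the three parameters.\<close>
  have bind: "measure_pmf.prob (bind_pmf M f) A = (\<integral>x. measure_pmf.prob (f x) A \<partial>M)"
    for M :: "'x pmf" and f :: "'x \<Rightarrow> 'y pmf" and A
    unfolding measure_pmf_bind by (rule measure_pmf.measure_bind[where N="count_space UNIV"]) (auto simp: measure_pmf_in_subprob_algebra)
  have token: "(\<integral>x. f x \<partial>token_pmf p) = p * f (1, 0) + (1 - p) * f (0, 1)" if "p \<in> {0..1}" for p and f :: "_ \<Rightarrow> real"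
    using that by (simp add: token_pmf_def)
  show "measure_pmf.prob (ptc_pmf p\<alpha> p\<beta> p\<gamma>) {(x, y, z). x = 1} = (1 - p\<beta>) * (1 - p\<gamma>) + p\<beta> * p\<gamma>"
    and "measure_pmf.prob (ptc_pmf p\<alpha> p\<beta> p\<gamma>) {(x, y, z). y = 1} = (1 - p\<gamma>) * (1 - p\<alpha>) + p\<gamma> * p\<alpha>"
    and "measure_pmf.prob (ptc_pmf p\<alpha> p\<beta> p\<gamma>) {(x, y, z). z = 1} = (1 - p\<alpha>) * (1 - p\<beta>) + p\<alpha> * p\<beta>"
    using assms
    by (simp_all add: ptc_pmf_def bind token parity_add_def indicator_def) (simp_all add: algebra_simps)
qed

lemma set_token_pmf: "set_pmf (token_pmf p) \<subseteq> {(1, 0), (0, 1)}"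
  by (auto simp: token_pmf_def)

text \<open>Every token is received by exactly one party, so the three counts add up to
  three.\<close>

lemma ptc_odd:
  assumes "(x, y, z) \<in> set_pmf (ptc_pmf p\<alpha> p\<beta> p\<gamma>)"
  shows "x \<oplus> y \<oplus> z = 1"
proof -
  from assms obtain A B C where ABC: "A \<in> set_pmf (token_pmf p\<alpha>)" "B \<in> set_pmf (token_pmf p\<beta>)"
      "C \<in> set_pmf (token_pmf p\<gamma>)"
    and xyz: "x = snd B \<oplus> fst C" "y = snd C \<oplus> fst A" "z = snd A \<oplus> fst B"
    by (auto simp only: ptc_pmf_def set_bind_pmf case_prod_unfold set_return_pmf UN_iff singleton_iff prod.inject)
  have token: "q = (1, 0) \<or> q = (0, 1)" if "q \<in> set_pmf (token_pmf p)" for q p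
    using set_token_pmf[of p] that by auto
  from token[OF ABC(1)] token[OF ABC(2)] token[OF ABC(3)] show ?thesis
    unfolding xyz by (elim disjE) (simp_all add: parity_add_def)
qed

section \<open>Almost everywhere statements on product spaces\<close>

text \<open>\<open>AE_pair\<close> freezes the first coordinate; exchanging the factors allows the
  second one to be frozen instead.\<close>

lemma AE_pair_swap:
  assumes "sigma_finite_measure M" "sigma_finite_measure N" and "AE (x, y) in M \<Otimes>\<^sub>M N. P x y"
  shows "AE (y, x) in N \<Otimes>\<^sub>M M. P x y"
proof -
  interpret M: sigma_finite_measure M by fact
  interpret N: sigma_finite_measure N by fact
  interpret pair_sigma_finite M N ..
  from assms(3) have "AE z in distr (N \<Otimes>\<^sub>M M) (M \<Otimes>\<^sub>M N) (\<lambda>(x, y). (y, x)). case z of (x, y) \<Rightarrow> P x y"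
    by (subst (asm) distr_pair_swap)
  from AE_distrD[OF measurable_pair_swap' this] show ?thesis by (simp add: case_prod_unfold)
qed

text \<open>Going from slices back to the product requires a measurable agreement set. For bits this
  set is the zero level of the parity of \<open>f\<close> and \<open>g\<close>.\<close>

lemma AE_pair_bit_eqI:
  assumes "sigma_finite_measure M" "sigma_finite_measure N"
    and f: "f \<in> M \<Otimes>\<^sub>M N \<rightarrow>\<^sub>M count_space {0, 1::nat}" and g: "g \<in> M \<Otimes>\<^sub>M N \<rightarrow>\<^sub>M count_space {0, 1::nat}"
    and "AE x in M. AE y in N. f (x, y) = g (x, y)"
  shows "AE z in M \<Otimes>\<^sub>M N. f z = g z"
proof -
  interpret M: sigma_finite_measure M by fact
  interpret N: sigma_finite_measure N by fact
  interpret pair_sigma_finite M N ..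
  have "(\<lambda>z. f z \<oplus> g z) -` {0} \<inter> space (M \<Otimes>\<^sub>M N) \<in> sets (M \<Otimes>\<^sub>M N)"
    by (intro measurable_sets[OF measurable_parity_add[OF f g]]) auto
  also have "(\<lambda>z. f z \<oplus> g z) -` {0} \<inter> space (M \<Otimes>\<^sub>M N) = {z \<in> space (M \<Otimes>\<^sub>M N). f z = g z}"
  proof (intro set_eqI)
    fix z
    show "z \<in> (\<lambda>z. f z \<oplus> g z) -` {0} \<inter> space (M \<Otimes>\<^sub>M N) \<longleftrightarrow> z \<in> {z \<in> space (M \<Otimes>\<^sub>M N). f z = g z}"
      using measurable_bitD[OF f, of z] measurable_bitD[OF g, of z] by (auto simp: parity_add_def)
  qed
  finally show ?thesis by (rule AE_pair_measure) fact
qed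

section \<open>Splitting the responses of a strategy into token functions\<close>

context triangle_strategy
begin

text \<open>Up to a constant, the token functions are sections of the responses at generic source
  values. The same \<open>s\<close>, \<open>t\<close>, \<open>u\<close> have to serve all three
  identities, so the later choices build on the decomposition of \<open>a\<close>.\<close>

lemma response_decomposition:
  assumes odd: "AE (\<alpha>, \<beta>, \<gamma>) in \<mu> \<Otimes>\<^sub>M \<eta> \<Otimes>\<^sub>M \<nu>. a (\<beta>, \<gamma>) \<oplus> b (\<gamma>, \<alpha>) \<oplus> c (\<alpha>, \<beta>) = 1"
  obtains s t u where
    "s \<in> \<mu> \<rightarrow>\<^sub>M count_space {0, 1}" "t \<in> \<eta> \<rightarrow>\<^sub>M count_space {0, 1}" "u \<in> \<nu> \<rightarrow>\<^sub>M count_space {0, 1}"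
    "AE (\<beta>, \<gamma>) in \<eta> \<Otimes>\<^sub>M \<nu>. a (\<beta>, \<gamma>) = (1 - t \<beta>) \<oplus> u \<gamma>"
    "AE (\<gamma>, \<alpha>) in \<nu> \<Otimes>\<^sub>M \<mu>. b (\<gamma>, \<alpha>) = (1 - u \<gamma>) \<oplus> s \<alpha>"
    "AE (\<alpha>, \<beta>) in \<mu> \<Otimes>\<^sub>M \<eta>. c (\<alpha>, \<beta>) = (1 - s \<alpha>) \<oplus> t \<beta>"
proof -
  interpret \<eta>\<nu>: pair_prob_space \<eta> \<nu> ..
  interpret \<nu>\<mu>: pair_prob_space \<nu> \<mu> ..
  interpret \<mu>\<eta>: pair_prob_space \<mu> \<eta> ..
  interpret \<mu>\<nu>: pair_prob_space \<mu> \<nu> ..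
  interpret \<mu>\<eta>\<nu>: pair_prob_space \<mu> "\<eta> \<Otimes>\<^sub>M \<nu>" ..
  interpret \<eta>\<nu>\<mu>: pair_prob_space "\<eta> \<Otimes>\<^sub>M \<nu>" \<mu> ..
  have bits: "a (\<beta>, \<gamma>) = 0 \<or> a (\<beta>, \<gamma>) = 1" "b (\<gamma>, \<alpha>) = 0 \<or> b (\<gamma>, \<alpha>) = 1" "c (\<alpha>, \<beta>) = 0 \<or> c (\<alpha>, \<beta>) = 1"
    if "\<alpha> \<in> space \<mu>" "\<beta> \<in> space \<eta>" "\<gamma> \<in> space \<nu>" for \<alpha> \<beta> \<gamma>
    using that measurable_bitD[OF measurable_a] measurable_bitD[OF measurable_b] measurable_bitD[OF measurable_c]
    by (simp_all add: space_pair_measure)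
  have odd1: "AE \<alpha> in \<mu>. AE (\<beta>, \<gamma>) in \<eta> \<Otimes>\<^sub>M \<nu>. a (\<beta>, \<gamma>) \<oplus> b (\<gamma>, \<alpha>) \<oplus> c (\<alpha>, \<beta>) = 1"
    using \<mu>\<eta>\<nu>.AE_pair[OF odd] by (simp add: case_prod_unfold)
  \<comment> \<open>Moving \<alpha> to the innermost position makes \<beta> outermost, so that it
    can be frozen as well.\<close>
  have "AE ((\<beta>, \<gamma>), \<alpha>) in (\<eta> \<Otimes>\<^sub>M \<nu>) \<Otimes>\<^sub>M \<mu>. a (\<beta>, \<gamma>) \<oplus> b (\<gamma>, \<alpha>) \<oplus> c (\<alpha>, \<beta>) = 1"
    using AE_pair_swap[OF alpha.sigma_finite_measure_axioms \<eta>\<nu>.P.sigma_finite_measure_axioms,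
        of "\<lambda>\<alpha> (\<beta>, \<gamma>). a (\<beta>, \<gamma>) \<oplus> b (\<gamma>, \<alpha>) \<oplus> c (\<alpha>, \<beta>) = 1"] odd
    by (simp add: case_prod_unfold)
  then have "AE z in \<eta> \<Otimes>\<^sub>M \<nu>. AE \<alpha> in \<mu>. a z \<oplus> b (snd z, \<alpha>) \<oplus> c (\<alpha>, fst z) = 1"
    by (auto dest: \<eta>\<nu>\<mu>.AE_pair simp add: case_prod_unfold)
  then have odd2: "AE \<beta> in \<eta>. AE \<gamma> in \<nu>. AE \<alpha> in \<mu>. a (\<beta>, \<gamma>) \<oplus> b (\<gamma>, \<alpha>) \<oplus> c (\<alpha>, \<beta>) = 1"
    by (auto dest: \<eta>\<nu>.AE_pair)

  \<comment> \<open>On a probability space, a property that holds almost everywhere holds at some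
    point.\<close>
  obtain \<alpha>0 where \<alpha>0: "\<alpha>0 \<in> space \<mu>" "AE (\<beta>, \<gamma>) in \<eta> \<Otimes>\<^sub>M \<nu>. a (\<beta>, \<gamma>) \<oplus> b (\<gamma>, \<alpha>0) \<oplus> c (\<alpha>0, \<beta>) = 1"
    using eventually_happens'[OF alpha.ae_filter_bot eventually_conj[OF AE_space odd1]] by auto
  \<comment> \<open>At \<alpha>0 the parity relation expresses \<open>a\<close> by sections of
    \<open>c\<close> and \<open>b\<close> and a constant 1. The constant is absorbed by
    complementing the \<beta>-part, which gives \<open>1 - t\<close>.\<close>
  define t where "t \<beta> = c (\<alpha>0, \<beta>)" for \<beta>
  define u where "u \<gamma> = b (\<gamma>, \<alpha>0)" for \<gamma>
  have t: "t \<in> \<eta> \<rightarrow>\<^sub>M count_space {0, 1}"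
    unfolding t_def using \<alpha>0 by (intro measurable_compose[OF _ measurable_c]) simp
  have u: "u \<in> \<nu> \<rightarrow>\<^sub>M count_space {0, 1}"
    unfolding u_def using \<alpha>0 by (intro measurable_compose[OF _ measurable_b]) simp
  have A: "AE (\<beta>, \<gamma>) in \<eta> \<Otimes>\<^sub>M \<nu>. a (\<beta>, \<gamma>) = (1 - t \<beta>) \<oplus> u \<gamma>"
    using \<alpha>0(2) AE_space
  proof eventually_elim
    case (elim z)
    then show ?case using bits[OF \<alpha>0(1), of "fst z" "snd z"]
      by (auto simp: space_pair_measure t_def u_def parity_add_def)
  qed
  then have A': "AE \<beta> in \<eta>. AE \<gamma> in \<nu>. a (\<beta>, \<gamma>) = (1 - t \<beta>) \<oplus> u \<gamma>"
    by (auto dest: \<eta>\<nu>.AE_pair)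

  \<comment> \<open>One value must be generic for both the parity relation and the decomposition of
    \<open>a\<close>, so that the latter can be substituted into the former.\<close>
  obtain \<beta>0 where \<beta>0: "\<beta>0 \<in> space \<eta>"
    "AE \<gamma> in \<nu>. AE \<alpha> in \<mu>. a (\<beta>0, \<gamma>) \<oplus> b (\<gamma>, \<alpha>) \<oplus> c (\<alpha>, \<beta>0) = 1"
    "AE \<gamma> in \<nu>. a (\<beta>0, \<gamma>) = (1 - t \<beta>0) \<oplus> u \<gamma>"
    using eventually_happens'[OF beta.ae_filter_bot eventually_conj[OF AE_space eventually_conj[OF odd2 A']]] by auto
  \<comment> \<open>Solve the parity relation at \<open>\<beta>0\<close> for \<open>b\<close>, with \<open>a\<close> already decomposed; the \<open>\<gamma>\<close>-part is then \<open>1 - u\<close>.\<close>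
  define s where "s \<alpha> = (1 - t \<beta>0) \<oplus> c (\<alpha>, \<beta>0)" for \<alpha>
  have s: "s \<in> \<mu> \<rightarrow>\<^sub>M count_space {0, 1}"
    unfolding s_def using \<beta>0(1) measurable_bitD[OF t \<beta>0(1)]
    by (intro measurable_parity_add measurable_compose[OF _ measurable_c]) auto
  note stu_bits = measurable_bitD[OF s] measurable_bitD[OF t] measurable_bitD[OF u]

  have "AE \<gamma> in \<nu>. AE \<alpha> in \<mu>. b (\<gamma>, \<alpha>) = (1 - u \<gamma>) \<oplus> s \<alpha>"
    using \<beta>0(2,3) AE_space
  proof eventually_elim
    case (elim \<gamma>)
    from elim(1) AE_space show ?case
    proof eventually_elim
      case (elim \<alpha>)
      with \<open>a (\<beta>0, \<gamma>) = (1 - t \<beta>0) \<oplus> u \<gamma>\<close> \<open>\<gamma> \<in> space \<nu>\<close> bits[of \<alpha> \<beta>0 \<gamma>] \<beta>0(1)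
        stu_bits(2)[of \<beta>0] stu_bits(3)[of \<gamma>]
      show ?case by (auto simp: s_def parity_add_def)
    qed
  qed
  then have B: "AE z in \<nu> \<Otimes>\<^sub>M \<mu>. b z = (case z of (\<gamma>, \<alpha>) \<Rightarrow> (1 - u \<gamma>) \<oplus> s \<alpha>)"
    unfolding case_prod_unfold
    by (intro AE_pair_bit_eqI measurable_b measurable_parity_add measurable_flip
        measurable_compose[OF measurable_fst u] measurable_compose[OF measurable_snd s]
        alpha.sigma_finite_measure_axioms gamma.sigma_finite_measure_axioms) simp
  then have "AE (\<gamma>, \<alpha>) in \<nu> \<Otimes>\<^sub>M \<mu>. b (\<gamma>, \<alpha>) = (1 - u \<gamma>) \<oplus> s \<alpha>"
    by (simp add: case_prod_unfold)
  \<comment> \<open>The last identity is derived with \<alpha> frozen, so that of \<open>b\<close>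
    is also needed with \<alpha> outermost.\<close>
  then have "AE (\<alpha>, \<gamma>) in \<mu> \<Otimes>\<^sub>M \<nu>. b (\<gamma>, \<alpha>) = (1 - u \<gamma>) \<oplus> s \<alpha>"
    by (rule AE_pair_swap[OF gamma.sigma_finite_measure_axioms alpha.sigma_finite_measure_axioms])
  then have B': "AE \<alpha> in \<mu>. AE \<gamma> in \<nu>. b (\<gamma>, \<alpha>) = (1 - u \<gamma>) \<oplus> s \<alpha>"
    by (auto dest: \<mu>\<nu>.AE_pair)

  have "AE \<alpha> in \<mu>. AE \<beta> in \<eta>. c (\<alpha>, \<beta>) = (1 - s \<alpha>) \<oplus> t \<beta>"
    using odd1 B' AE_space
  proof eventually_elim
    case \<alpha>: (elim \<alpha>)
    have "AE \<beta> in \<eta>. AE \<gamma> in \<nu>. a (\<beta>, \<gamma>) \<oplus> b (\<gamma>, \<alpha>) \<oplus> c (\<alpha>, \<beta>) = 1"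
      using \<eta>\<nu>.AE_pair[OF \<alpha>(1)] by simp
    from this A' AE_space show ?case
    proof eventually_elim
      case \<beta>: (elim \<beta>)
      from \<beta>(1,2) \<alpha>(2) AE_space have "AE \<gamma> in \<nu>. c (\<alpha>, \<beta>) = (1 - s \<alpha>) \<oplus> t \<beta>"
      proof eventually_elim
        case (elim \<gamma>)
        from elim(1-3) show ?case
          using bits(3)[OF \<alpha>(3) \<beta>(3) elim(4)] stu_bits(1)[OF \<alpha>(3)] stu_bits(2)[OF \<beta>(3)] stu_bits(3)[OF elim(4)]
          by (elim disjE) (simp_all add: parity_add_def)
      qed
      then show ?case by (simp add: gamma.AE_const)
    qed
  qed
  then have C: "AE z in \<mu> \<Otimes>\<^sub>M \<eta>. c z = (case z of (\<alpha>, \<beta>) \<Rightarrow> (1 - s \<alpha>) \<oplus> t \<beta>)"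
    unfolding case_prod_unfold
    by (intro AE_pair_bit_eqI measurable_c measurable_parity_add measurable_flip
        measurable_compose[OF measurable_fst s] measurable_compose[OF measurable_snd t]
        alpha.sigma_finite_measure_axioms beta.sigma_finite_measure_axioms) simp
  show thesis by (rule that[OF s t u A]) (use B C in \<open>simp_all add: case_prod_unfold\<close>)
qed

section \<open>Marginals of the outcome law\<close>

lemma measurable_outcome:
  "(\<lambda>(\<alpha>, \<beta>, \<gamma>). (a (\<beta>, \<gamma>), b (\<gamma>, \<alpha>), c (\<alpha>, \<beta>))) \<in> \<mu> \<Otimes>\<^sub>M \<eta> \<Otimes>\<^sub>M \<nu> \<rightarrow>\<^sub>M count_space UNIV"
proof -
  have bit: "h \<in> M \<rightarrow>\<^sub>M count_space UNIV" if "h \<in> M \<rightarrow>\<^sub>M count_space {0, 1::nat}" for h and M :: "'x measure"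
    by (rule measurable_compose[OF that]) simp
  note [measurable] = bit[OF measurable_a] bit[OF measurable_b] bit[OF measurable_c]
  have "(\<lambda>(\<alpha>, \<beta>, \<gamma>). (a (\<beta>, \<gamma>), b (\<gamma>, \<alpha>), c (\<alpha>, \<beta>)))
      \<in> \<mu> \<Otimes>\<^sub>M \<eta> \<Otimes>\<^sub>M \<nu> \<rightarrow>\<^sub>M count_space UNIV \<Otimes>\<^sub>M count_space UNIV \<Otimes>\<^sub>M count_space UNIV"
    by measurable
  then show ?thesis by (simp add: pair_measure_countable)
qed

text \<open>The source that a party does not see has total mass one and integrates out. The second
  projection reverses the order of its coordinates because \<open>b\<close> takes \<gamma> before
  \<alpha>.\<close>

lemma product_projections:
  shows "\<eta> \<Otimes>\<^sub>M \<nu> = distr (\<mu> \<Otimes>\<^sub>M \<eta> \<Otimes>\<^sub>M \<nu>) (\<eta> \<Otimes>\<^sub>M \<nu>) snd"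
    and "\<nu> \<Otimes>\<^sub>M \<mu> = distr (\<mu> \<Otimes>\<^sub>M \<eta> \<Otimes>\<^sub>M \<nu>) (\<nu> \<Otimes>\<^sub>M \<mu>) (\<lambda>w. (snd (snd w), fst w))"
    and "\<mu> \<Otimes>\<^sub>M \<eta> = distr (\<mu> \<Otimes>\<^sub>M \<eta> \<Otimes>\<^sub>M \<nu>) (\<mu> \<Otimes>\<^sub>M \<eta>) (\<lambda>w. (fst w, fst (snd w)))"
proof -
  interpret \<eta>\<nu>: pair_prob_space \<eta> \<nu> ..
  note times = \<eta>\<nu>.P.emeasure_pair_measure_Times gamma.emeasure_pair_measure_Times
    alpha.emeasure_space_1 beta.emeasure_space_1 gamma.emeasure_space_1
  \<comment> \<open>A product of sigma-finite measures is determined by its values on rectangles.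
    The preimage of a rectangle is a box that is full in the unseen coordinate.\<close>
  have proj: "M \<Otimes>\<^sub>M N = distr (\<mu> \<Otimes>\<^sub>M \<eta> \<Otimes>\<^sub>M \<nu>) (M \<Otimes>\<^sub>M N) \<pi>"
    if "prob_space M" "prob_space N" and \<pi>: "\<pi> \<in> \<mu> \<Otimes>\<^sub>M \<eta> \<Otimes>\<^sub>M \<nu> \<rightarrow>\<^sub>M M \<Otimes>\<^sub>M N"
      and "\<And>A B. A \<in> sets M \<Longrightarrow> B \<in> sets N \<Longrightarrow>
        emeasure (\<mu> \<Otimes>\<^sub>M \<eta> \<Otimes>\<^sub>M \<nu>) (\<pi> -` (A \<times> B) \<inter> space (\<mu> \<Otimes>\<^sub>M \<eta> \<Otimes>\<^sub>M \<nu>)) = emeasure M A * emeasure N B"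
    for M :: "'x measure" and N :: "'y measure" and \<pi>
    using that
    by (intro pair_measure_eqI) (simp_all add: emeasure_distr[OF \<pi>] prob_space_imp_sigma_finite)
  show "\<eta> \<Otimes>\<^sub>M \<nu> = distr (\<mu> \<Otimes>\<^sub>M \<eta> \<Otimes>\<^sub>M \<nu>) (\<eta> \<Otimes>\<^sub>M \<nu>) snd"
  proof (rule proj)
    fix A B assume AB: "A \<in> sets \<eta>" "B \<in> sets \<nu>"
    then have "snd -` (A \<times> B) \<inter> space (\<mu> \<Otimes>\<^sub>M \<eta> \<Otimes>\<^sub>M \<nu>) = space \<mu> \<times> A \<times> B"
      using AB[THEN sets.sets_into_space] by (auto simp: space_pair_measure)
    with AB show "emeasure (\<mu> \<Otimes>\<^sub>M \<eta> \<Otimes>\<^sub>M \<nu>) (snd -` (A \<times> B) \<inter> space (\<mu> \<Otimes>\<^sub>M \<eta> \<Otimes>\<^sub>M \<nu>))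
      = emeasure \<eta> A * emeasure \<nu> B" by (simp add: times)
  qed (simp_all add: beta.prob_space_axioms gamma.prob_space_axioms)
  show "\<nu> \<Otimes>\<^sub>M \<mu> = distr (\<mu> \<Otimes>\<^sub>M \<eta> \<Otimes>\<^sub>M \<nu>) (\<nu> \<Otimes>\<^sub>M \<mu>) (\<lambda>w. (snd (snd w), fst w))"
  proof (rule proj)
    fix A B assume AB: "A \<in> sets \<nu>" "B \<in> sets \<mu>"
    then have "(\<lambda>w. (snd (snd w), fst w)) -` (A \<times> B) \<inter> space (\<mu> \<Otimes>\<^sub>M \<eta> \<Otimes>\<^sub>M \<nu>) = B \<times> space \<eta> \<times> A"
      using AB[THEN sets.sets_into_space] by (auto simp: space_pair_measure)
    with AB show "emeasure (\<mu> \<Otimes>\<^sub>M \<eta> \<Otimes>\<^sub>M \<nu>)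
        ((\<lambda>w. (snd (snd w), fst w)) -` (A \<times> B) \<inter> space (\<mu> \<Otimes>\<^sub>M \<eta> \<Otimes>\<^sub>M \<nu>))
      = emeasure \<nu> A * emeasure \<mu> B" by (simp add: times mult.commute)
  qed (simp_all add: alpha.prob_space_axioms gamma.prob_space_axioms)
  show "\<mu> \<Otimes>\<^sub>M \<eta> = distr (\<mu> \<Otimes>\<^sub>M \<eta> \<Otimes>\<^sub>M \<nu>) (\<mu> \<Otimes>\<^sub>M \<eta>) (\<lambda>w. (fst w, fst (snd w)))"
  proof (rule proj)
    fix A B assume AB: "A \<in> sets \<mu>" "B \<in> sets \<eta>"
    then have "(\<lambda>w. (fst w, fst (snd w))) -` (A \<times> B) \<inter> space (\<mu> \<Otimes>\<^sub>M \<eta> \<Otimes>\<^sub>M \<nu>) = A \<times> B \<times> space \<nu>"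
      using AB[THEN sets.sets_into_space] by (auto simp: space_pair_measure)
    with AB show "emeasure (\<mu> \<Otimes>\<^sub>M \<eta> \<Otimes>\<^sub>M \<nu>)
        ((\<lambda>w. (fst w, fst (snd w))) -` (A \<times> B) \<inter> space (\<mu> \<Otimes>\<^sub>M \<eta> \<Otimes>\<^sub>M \<nu>))
      = emeasure \<mu> A * emeasure \<eta> B" by (simp add: times)
  qed (simp_all add: alpha.prob_space_axioms beta.prob_space_axioms)
qed

text \<open>This brings the single-party probabilities from the triple product, where the outcome
  law is defined, to the pair products on which \<open>prob_parity\<close> computes them.\<close>

lemma outcome_marginals:
  shows "measure (outcome_law \<mu> \<eta> \<nu> a b c) {(x, y, z). x = 1} = measure (\<eta> \<Otimes>\<^sub>M \<nu>) {z \<in> space (\<eta> \<Otimes>\<^sub>M \<nu>). a z = 1}"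
    and "measure (outcome_law \<mu> \<eta> \<nu> a b c) {(x, y, z). y = 1} = measure (\<nu> \<Otimes>\<^sub>M \<mu>) {z \<in> space (\<nu> \<Otimes>\<^sub>M \<mu>). b z = 1}"
    and "measure (outcome_law \<mu> \<eta> \<nu> a b c) {(x, y, z). z = 1} = measure (\<mu> \<Otimes>\<^sub>M \<eta>) {z \<in> space (\<mu> \<Otimes>\<^sub>M \<eta>). c z = 1}"
proof -
  \<comment> \<open>Here \<open>f\<close> selects one output, \<open>\<pi>\<close> the two sources
    seen by that party, and \<open>h\<close> is its response.\<close>
  have marginal: "measure (outcome_law \<mu> \<eta> \<nu> a b c) {w. f w = 1} = measure N {z \<in> space N. h z = 1}"
    if h: "h \<in> N \<rightarrow>\<^sub>M count_space {0, 1::nat}"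
      and \<pi>: "\<pi> \<in> \<mu> \<Otimes>\<^sub>M \<eta> \<Otimes>\<^sub>M \<nu> \<rightarrow>\<^sub>M N" and N: "N = distr (\<mu> \<Otimes>\<^sub>M \<eta> \<Otimes>\<^sub>M \<nu>) N \<pi>"
      and fh: "\<And>\<alpha> \<beta> \<gamma>. f (a (\<beta>, \<gamma>), b (\<gamma>, \<alpha>), c (\<alpha>, \<beta>)) = h (\<pi> (\<alpha>, \<beta>, \<gamma>))"
    for f :: "nat \<times> nat \<times> nat \<Rightarrow> nat" and N :: "'x measure" and h \<pi>
  proof -
    have "h -` {1} \<inter> space N \<in> sets N" by (intro measurable_sets[OF h]) auto
    then have "{z \<in> space N. h z = 1} \<in> sets N" by (simp add: vimage_def Int_def conj_commute)
    then have "measure N {z \<in> space N. h z = 1}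
        = measure (\<mu> \<Otimes>\<^sub>M \<eta> \<Otimes>\<^sub>M \<nu>) (\<pi> -` {z \<in> space N. h z = 1} \<inter> space (\<mu> \<Otimes>\<^sub>M \<eta> \<Otimes>\<^sub>M \<nu>))"
      by (subst N) (rule measure_distr[OF \<pi>])
    also have "\<pi> -` {z \<in> space N. h z = 1} \<inter> space (\<mu> \<Otimes>\<^sub>M \<eta> \<Otimes>\<^sub>M \<nu>) =
        (\<lambda>(\<alpha>, \<beta>, \<gamma>). (a (\<beta>, \<gamma>), b (\<gamma>, \<alpha>), c (\<alpha>, \<beta>))) -` {w. f w = 1} \<inter> space (\<mu> \<Otimes>\<^sub>M \<eta> \<Otimes>\<^sub>M \<nu>)"
      using measurable_space[OF \<pi>] by (auto simp: fh)
    finally show ?thesis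
      unfolding outcome_law_def by (simp add: measure_distr[OF measurable_outcome])
  qed
  show "measure (outcome_law \<mu> \<eta> \<nu> a b c) {(x, y, z). x = 1} = measure (\<eta> \<Otimes>\<^sub>M \<nu>) {z \<in> space (\<eta> \<Otimes>\<^sub>M \<nu>). a z = 1}"
    using marginal[OF measurable_a _ product_projections(1), of fst] by (simp add: case_prod_unfold)
  show "measure (outcome_law \<mu> \<eta> \<nu> a b c) {(x, y, z). y = 1} = measure (\<nu> \<Otimes>\<^sub>M \<mu>) {z \<in> space (\<nu> \<Otimes>\<^sub>M \<mu>). b z = 1}"
    using marginal[OF measurable_b _ product_projections(2), of "\<lambda>w. fst (snd w)"] by (simp add: case_prod_unfold)
  show "measure (outcome_law \<mu> \<eta> \<nu> a b c) {(x, y, z). z = 1} = measure (\<mu> \<Otimes>\<^sub>M \<eta>) {z \<in> space (\<mu> \<Otimes>\<^sub>M \<eta>). c z = 1}"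
    using marginal[OF measurable_c _ product_projections(3), of "\<lambda>w. snd (snd w)"] by (simp add: case_prod_unfold)
qed

end

section \<open>Rigidity of parity token counting\<close>

theorem theorem1:
  fixes p\<alpha> p\<beta> p\<gamma> :: real
    and \<mu> :: "'s measure" and \<eta> :: "'t measure" and \<nu> :: "'u measure"
    and a :: "'t \<times> 'u \<Rightarrow> nat" and b :: "'u \<times> 's \<Rightarrow> nat" and c :: "'s \<times> 't \<Rightarrow> nat"
  assumes "p\<alpha> \<in> {0..1}" and "p\<beta> \<in> {0..1}" and "p\<gamma> \<in> {0..1}"
    and "triangle_strategy \<mu> \<eta> \<nu> a b c"
    and "outcome_law \<mu> \<eta> \<nu> a b c = measure_pmf (ptc_pmf p\<alpha> p\<beta> p\<gamma>)"
  shows "\<exists>T\<alpha>b \<in> \<mu> \<rightarrow>\<^sub>M count_space {0, 1}. \<exists>T\<alpha>c \<in> \<mu> \<rightarrow>\<^sub>M count_space {0, 1}.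
         \<exists>T\<beta>c \<in> \<eta> \<rightarrow>\<^sub>M count_space {0, 1}. \<exists>T\<beta>a \<in> \<eta> \<rightarrow>\<^sub>M count_space {0, 1}.
         \<exists>T\<gamma>a \<in> \<nu> \<rightarrow>\<^sub>M count_space {0, 1}. \<exists>T\<gamma>b \<in> \<nu> \<rightarrow>\<^sub>M count_space {0, 1 :: nat}.
           (\<forall>\<alpha> \<in> space \<mu>. T\<alpha>b \<alpha> + T\<alpha>c \<alpha> = (1 :: nat)) \<and>
           (\<forall>\<beta> \<in> space \<eta>. T\<beta>c \<beta> + T\<beta>a \<beta> = (1 :: nat)) \<and>
           (\<forall>\<gamma> \<in> space \<nu>. T\<gamma>a \<gamma> + T\<gamma>b \<gamma> = (1 :: nat)) \<and>
           (AE (\<beta>, \<gamma>) in \<eta> \<Otimes>\<^sub>M \<nu>. a (\<beta>, \<gamma>) = T\<beta>a \<beta> \<oplus> T\<gamma>a \<gamma>) \<and>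
           (AE (\<gamma>, \<alpha>) in \<nu> \<Otimes>\<^sub>M \<mu>. b (\<gamma>, \<alpha>) = T\<gamma>b \<gamma> \<oplus> T\<alpha>b \<alpha>) \<and>
           (AE (\<alpha>, \<beta>) in \<mu> \<Otimes>\<^sub>M \<eta>. c (\<alpha>, \<beta>) = T\<alpha>c \<alpha> \<oplus> T\<beta>c \<beta>) \<and>
           (measure_pmf.prob (ptc_pmf p\<alpha> p\<beta> p\<gamma>) {(x, y, z). x = 1} \<noteq> 1 / 2 \<and>
            measure_pmf.prob (ptc_pmf p\<alpha> p\<beta> p\<gamma>) {(x, y, z). y = 1} \<noteq> 1 / 2 \<and>
            measure_pmf.prob (ptc_pmf p\<alpha> p\<beta> p\<gamma>) {(x, y, z). z = 1} \<noteq> 1 / 2 \<longrightarrow>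
            (\<integral>\<alpha>. real (T\<alpha>b \<alpha>) \<partial>\<mu>) = p\<alpha> \<and>
            (\<integral>\<beta>. real (T\<beta>c \<beta>) \<partial>\<eta>) = p\<beta> \<and>
            (\<integral>\<gamma>. real (T\<gamma>a \<gamma>) \<partial>\<nu>) = p\<gamma>)"
proof -
  interpret triangle_strategy \<mu> \<eta> \<nu> a b c by fact
  let ?prob = "measure_pmf.prob (ptc_pmf p\<alpha> p\<beta> p\<gamma>)"
  note law = \<open>outcome_law \<mu> \<eta> \<nu> a b c = measure_pmf (ptc_pmf p\<alpha> p\<beta> p\<gamma>)\<close>
  \<comment> \<open>Oddness holds on the support of the token counting law, hence almost surely for
    the outcomes, and is then pulled back to the sources.\<close>
  have "AE (x, y, z) in outcome_law \<mu> \<eta> \<nu> a b c. x \<oplus> y \<oplus> z = 1"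
    unfolding law by (auto intro!: AE_pmfI dest: ptc_odd)
  from AE_distrD[OF measurable_outcome this[unfolded outcome_law_def]]
  have "AE (\<alpha>, \<beta>, \<gamma>) in \<mu> \<Otimes>\<^sub>M \<eta> \<Otimes>\<^sub>M \<nu>. a (\<beta>, \<gamma>) \<oplus> b (\<gamma>, \<alpha>) \<oplus> c (\<alpha>, \<beta>) = 1"
    by (simp add: case_prod_unfold)
  then obtain s t u where
    meas: "s \<in> \<mu> \<rightarrow>\<^sub>M count_space {0, 1}" "t \<in> \<eta> \<rightarrow>\<^sub>M count_space {0, 1}" "u \<in> \<nu> \<rightarrow>\<^sub>M count_space {0, 1}"
    and A: "AE (\<beta>, \<gamma>) in \<eta> \<Otimes>\<^sub>M \<nu>. a (\<beta>, \<gamma>) = (1 - t \<beta>) \<oplus> u \<gamma>"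
    and B: "AE (\<gamma>, \<alpha>) in \<nu> \<Otimes>\<^sub>M \<mu>. b (\<gamma>, \<alpha>) = (1 - u \<gamma>) \<oplus> s \<alpha>"
    and C: "AE (\<alpha>, \<beta>) in \<mu> \<Otimes>\<^sub>M \<eta>. c (\<alpha>, \<beta>) = (1 - s \<alpha>) \<oplus> t \<beta>"
    by (rule response_decomposition)
  note bits = measurable_bitD[OF meas(1)] measurable_bitD[OF meas(2)] measurable_bitD[OF meas(3)]
  note flips = measurable_flip[OF meas(1)] measurable_flip[OF meas(2)] measurable_flip[OF meas(3)]
  define S T U where STU: "S = (\<integral>\<alpha>. s \<alpha> \<partial>\<mu>)" "T = (\<integral>\<beta>. t \<beta> \<partial>\<eta>)" "U = (\<integral>\<gamma>. u \<gamma> \<partial>\<nu>)"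
  \<comment> \<open>The \<beta>-part of \<open>a\<close> is \<open>1 - t\<close>, with mean
    \<open>1 - T\<close>; this brings the marginal to the form of \<open>ptc_marginals\<close> with
    means in place of parameters.\<close>
  have "(1 - T) * (1 - U) + T * U = ?prob {(x, y, z). x = 1}"
    using prob_parity[OF beta.prob_space_axioms gamma.prob_space_axioms flips(2) meas(3) measurable_a A,
        unfolded integral_flip[OF beta.prob_space_axioms meas(2)]]
      outcome_marginals(1)
    by (simp add: law STU algebra_simps)
  moreover have "(1 - U) * (1 - S) + U * S = ?prob {(x, y, z). y = 1}"
    using prob_parity[OF gamma.prob_space_axioms alpha.prob_space_axioms flips(3) meas(1) measurable_b B,
        unfolded integral_flip[OF gamma.prob_space_axioms meas(3)]]
      outcome_marginals(2)
    by (simp add: law STU algebra_simps)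
  moreover have "(1 - S) * (1 - T) + S * T = ?prob {(x, y, z). z = 1}"
    using prob_parity[OF alpha.prob_space_axioms beta.prob_space_axioms flips(1) meas(2) measurable_c C,
        unfolded integral_flip[OF alpha.prob_space_axioms meas(1)]]
      outcome_marginals(3)
    by (simp add: law STU algebra_simps)
  ultimately have sign: "S = p\<alpha> \<and> T = p\<beta> \<and> U = p\<gamma> \<or> 1 - S = p\<alpha> \<and> 1 - T = p\<beta> \<and> 1 - U = p\<gamma>"
    if "?prob {(x, y, z). x = 1} \<noteq> 1 / 2" "?prob {(x, y, z). y = 1} \<noteq> 1 / 2"
      "?prob {(x, y, z). z = 1} \<noteq> 1 / 2"
    using that sign_ambiguity[of T U p\<beta> p\<gamma> S p\<alpha>] unfolding ptc_marginals[OF assms(1-3)] by blast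
  let ?biased = "?prob {(x, y, z). x = 1} \<noteq> 1 / 2 \<and> ?prob {(x, y, z). y = 1} \<noteq> 1 / 2 \<and>
    ?prob {(x, y, z). z = 1} \<noteq> 1 / 2"
  \<comment> \<open>Complements supply the other three token functions, so both signs reduce to
    giving one function per source.\<close>
  have witness: ?thesis
    if f: "f \<in> \<mu> \<rightarrow>\<^sub>M count_space {0, 1}" and g: "g \<in> \<eta> \<rightarrow>\<^sub>M count_space {0, 1}"
      and h: "h \<in> \<nu> \<rightarrow>\<^sub>M count_space {0, 1}"
      and ids: "AE (\<beta>, \<gamma>) in \<eta> \<Otimes>\<^sub>M \<nu>. a (\<beta>, \<gamma>) = (1 - g \<beta>) \<oplus> h \<gamma>"
        "AE (\<gamma>, \<alpha>) in \<nu> \<Otimes>\<^sub>M \<mu>. b (\<gamma>, \<alpha>) = (1 - h \<gamma>) \<oplus> f \<alpha>"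
        "AE (\<alpha>, \<beta>) in \<mu> \<Otimes>\<^sub>M \<eta>. c (\<alpha>, \<beta>) = (1 - f \<alpha>) \<oplus> g \<beta>"
      and means: "?biased \<longrightarrow>
        (\<integral>\<alpha>. f \<alpha> \<partial>\<mu>) = p\<alpha> \<and> (\<integral>\<beta>. g \<beta> \<partial>\<eta>) = p\<beta> \<and> (\<integral>\<gamma>. h \<gamma> \<partial>\<nu>) = p\<gamma>"
    for f g h
  proof (rule bexI[OF _ f], rule bexI[OF _ measurable_flip[OF f]], rule bexI[OF _ g],
      rule bexI[OF _ measurable_flip[OF g]], rule bexI[OF _ h], rule bexI[OF _ measurable_flip[OF h]],
      intro conjI ballI)
    show "f \<alpha> + (1 - f \<alpha>) = 1" if "\<alpha> \<in> space \<mu>" for \<alpha>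
      using measurable_bitD[OF f that] by auto
    show "g \<beta> + (1 - g \<beta>) = 1" if "\<beta> \<in> space \<eta>" for \<beta>
      using measurable_bitD[OF g that] by auto
    show "h \<gamma> + (1 - h \<gamma>) = 1" if "\<gamma> \<in> space \<nu>" for \<gamma>
      using measurable_bitD[OF h that] by auto
  qed (fact ids means)+
  show ?thesis
  \<comment> \<open>The case \<open>False\<close> covers two situations, both served by
    \<open>s\<close>, \<open>t\<close>, \<open>u\<close>: some marginal is uniform and nothing is
    claimed about means, or the means are already right.\<close>
  proof (cases "?biased \<and> \<not> (S = p\<alpha> \<and> T = p\<beta> \<and> U = p\<gamma>)")
    case False
    then show ?thesis
      by (intro witness[OF meas A B C]) (auto simp: STU)
  next
    case True
    \<comment> \<open>Exchanging the recipients of both tokens flips both summands and preserves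
      their parity.\<close>
    have unflip: "(1 - (1 - i)) \<oplus> (1 - j) = (1 - i) \<oplus> j" if "i = 0 \<or> i = 1" "j = 0 \<or> j = 1" for i j :: nat
      using that by (auto simp: parity_add_def)
    show ?thesis
    proof (rule witness[OF flips])
      show "AE (\<beta>, \<gamma>) in \<eta> \<Otimes>\<^sub>M \<nu>. a (\<beta>, \<gamma>) = (1 - (1 - t \<beta>)) \<oplus> (1 - u \<gamma>)"
        using A AE_space by eventually_elim (clarsimp simp only: space_pair_measure mem_Times_iff fst_conv snd_conv unflip[OF bits(2) bits(3)])
      show "AE (\<gamma>, \<alpha>) in \<nu> \<Otimes>\<^sub>M \<mu>. b (\<gamma>, \<alpha>) = (1 - (1 - u \<gamma>)) \<oplus> (1 - s \<alpha>)"
        using B AE_space by eventually_elim (clarsimp simp only: space_pair_measure mem_Times_iff fst_conv snd_conv unflip[OF bits(3) bits(1)])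
      show "AE (\<alpha>, \<beta>) in \<mu> \<Otimes>\<^sub>M \<eta>. c (\<alpha>, \<beta>) = (1 - (1 - s \<alpha>)) \<oplus> (1 - t \<beta>)"
        using C AE_space by eventually_elim (clarsimp simp only: space_pair_measure mem_Times_iff fst_conv snd_conv unflip[OF bits(1) bits(2)])
    \<comment> \<open>Only the second alternative of \<open>sign\<close> remains, and it states that
      the flipped functions have the required means.\<close>
    qed (use True sign in \<open>auto simp: STU integral_flip alpha.prob_space_axioms beta.prob_space_axioms
        gamma.prob_space_axioms meas simp del: One_nat_def\<close>)
  qed
qed

end
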